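(* Let $\mu_1,\mu_2\in\mathbb{C}$ with $\mu_1+\mu_2\notin\mathbb{Z}$. Then the vectors $w_{k,l,m}$, $k,l\in\mathbb{Z}$, $m\in\mathbb{Z}_{\ge 0}$, form a basis of $M_{\mu_1,\mu_2}$ consisting of simultaneous eigenvectors with respect to the triple of endomorphisms $(h_1,h_2,f_{12}e_{12})$. Moreover, the simultaneous eigenvalues determine $(k,l,m)$ uniquely, i.e. if $w_{k,l,m}$ and $w_{k',l',m'}$ have the same simultaneous eigenvalue, then $(k,l,m)=(k',l',m')$.
   Context: $\mathfrak{sl}_3$ is the complex Lie algebra with root vectors $e_1,e_2,e_{12}=[e_1,e_2]$ (roots $\alpha_1,\alpha_2,\alpha_1+\alpha_2$), $f_1,f_2,f_{12}=-[f_1,f_2]$ (the negative roots), and simple coroots $h_1,h_2$ spanning the Cartan subalgebra $\mathfrak{t}$; e.g. $e_1=E_{12}$, $e_2=E_{23}$, $e_{12}=E_{13}$, $f_1=E_{21}$, $f_2=E_{32}$, $f_{12}=E_{31}$. For $\mu_1,\mu_2\in\mathbb{C}$ the $\mathfrak{sl}_3$-module $M_{\mu_1,\mu_2}$ is the space of global sections of a rank one local system on $O=X_{w_\circ}\cap s_1X_{w_\circ}\cap s_2X_{w_\circ}\cong\mathbb{G}_m^2\times\mathbb{A}^1$ ($X_{w_\circ}$ the big cell of the flag variety of $\mathrm{SL}_3$), on which $\mathfrak{sl}_3$ acts by infinitesimal left translations. Explicitly, write $\overline{k}=k-\mu_1$ and $\overline{l}=l-\mu_2$. Then $M_{\mu_1,\mu_2}$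 has the $\mathbb{C}$-basis $u_{k,l,m}$, $k,l\in\mathbb{Z}$, $m\in\mathbb{Z}_{\ge0}$, with action $$e_1u_{k,l,m}=-\overline{k}\,u_{k-1,l,m},\qquad e_2u_{k,l,m}=-\overline{l}\,u_{k,l-1,m}+m\,u_{k+1,l,m-1},$$ $$h\,u_{k,l,m}=-\big((\overline{k}+m)\alpha_1(h)+(\overline{l}+m)\alpha_2(h)\big)u_{k,l,m}\quad(h\in\mathfrak{t}),$$ $$f_1u_{k,l,m}=(\overline{k}-\overline{l}+m)u_{k+1,l,m}-\overline{l}\,u_{k,l-1,m+1},\qquad f_2u_{k,l,m}=\overline{l}\,u_{k,l+1,m}+\overline{k}\,u_{k-1,l,m+1},$$ $$e_{12}u_{k,l,m}=-m\,u_{k,l,m-1},\qquad f_{12}u_{k,l,m}=(\overline{k}+\overline{l}+m)u_{k,l,m+1}+\overline{l}\,u_{k+1,l+1,m}$$ (terms with coefficient $m=0$ are zero). When $\mu_1+\mu_2\notin\mathbb{Z}$ define $$w_{k,l,m}=\sum_{n=0}^m\binom{m}{n}\frac{\overline{l}^{(n)}}{(\overline{k}+\overline{l})^{(n)}}\,u_{k+n,l+n,m-n},$$ where $x^{(n)}=x(x+1)\cdots(x+n-1)$ is the raising factorial. *)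

theory Defs
  imports "HOL-Analysis.Analysis" "HOL-Library.Poly_Mapping"
begin

section \<open>The Lie algebra sl3\<close>

type_synonym mat3 = "complex ^ 3 ^ 3"

definition lie_bracket :: "mat3 \<Rightarrow> mat3 \<Rightarrow> mat3" where
  "lie_bracket A B = A ** B - B ** A"

definition sl3 :: "mat3 set" where
  "sl3 = {A. trace A = 0}"

definition matrix_unit :: "3 \<Rightarrow> 3 \<Rightarrow> mat3" where
  "matrix_unit i j = (\<chi> a b. if a = i \<and> b = j then 1 else 0)"

definition E1 :: mat3 where "E1 = matrix_unit 1 2"
definition E2 :: mat3 where "E2 = matrix_unit 2 3"
definition E12 :: mat3 where "E12 = lie_bracket E1 E2"
definition F1 :: mat3 where "F1 = matrix_unit 2 1"
definition F2 :: mat3 where "F2 = matrix_unit 3 2"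
definition F12 :: mat3 where "F12 = - lie_bracket F1 F2"
definition H1 :: mat3 where "H1 = lie_bracket E1 F1"
definition H2 :: mat3 where "H2 = lie_bracket E2 F2"

definition root1 :: "mat3 \<Rightarrow> complex" where "root1 X = X $ 1 $ 1 - X $ 2 $ 2"
definition root2 :: "mat3 \<Rightarrow> complex" where "root2 X = X $ 2 $ 2 - X $ 3 $ 3"


section \<open>The underlying vector space\<close>

text \<open>
  The complex vector space with basis \<open>u k l m\<close> is the space of finitely supported functions on
  the index set. Poly_Mapping provides its additive group structure but no scalar multiplication.
\<close>

type_synonym M = "(int \<times> int \<times> nat) \<Rightarrow>\<^sub>0 complex"

definition scaleM :: "complex \<Rightarrow> M \<Rightarrow> M" (infixr "\<cdot>" 75) where
  "c \<cdot> v = Poly_Mapping.map (\<lambda>x. c * x) v"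

lemma lookup_scaleM [simp]: "Poly_Mapping.lookup (c \<cdot> v) i = c * Poly_Mapping.lookup v i"
  by (simp add: scaleM_def Poly_Mapping.map.rep_eq when_def)

global_interpretation M: vector_space scaleM
  by standard (auto intro!: poly_mapping_eqI simp: lookup_add distrib_left distrib_right)

definition u_vec :: "int \<Rightarrow> int \<Rightarrow> nat \<Rightarrow> M" where
  "u_vec k l m = Poly_Mapping.single (k, l, m) 1"

definition basis_family :: "('i \<Rightarrow> M) \<Rightarrow> bool" where
  "basis_family b \<longleftrightarrow> inj b \<and> M.independent (range b) \<and> M.span (range b) = UNIV"


section \<open>The module structure\<close>

text \<open>
  The action of a matrix \<open>X\<close> on a basis vector, written out along the decomposition of \<open>X\<close> into
  its off-diagonal entries (the coefficients of the six root vectors) and its diagonal part.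
  In the terms involving \<open>m - 1\<close> (truncated subtraction) the coefficient is \<open>0\<close> if \<open>m = 0\<close>.
\<close>

definition act_basis :: "complex \<Rightarrow> complex \<Rightarrow> mat3 \<Rightarrow> int \<times> int \<times> nat \<Rightarrow> M" where
  "act_basis \<mu>1 \<mu>2 X = (\<lambda>(k, l, m).
     let k' = of_int k - \<mu>1; l' = of_int l - \<mu>2; m' = of_nat m in
       (X $ 1 $ 2) \<cdot> (- k') \<cdot> u_vec (k - 1) l m
     + (X $ 2 $ 3) \<cdot> ((- l') \<cdot> u_vec k (l - 1) m + m' \<cdot> u_vec (k + 1) l (m - 1))
     + (X $ 1 $ 3) \<cdot> (- m') \<cdot> u_vec k l (m - 1)
     + (- ((k' + m') * root1 X + (l' + m') * root2 X)) \<cdot> u_vec k l m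
     + (X $ 2 $ 1) \<cdot> ((k' - l' + m') \<cdot> u_vec (k + 1) l m + (- l') \<cdot> u_vec k (l - 1) (m + 1))
     + (X $ 3 $ 2) \<cdot> (l' \<cdot> u_vec k (l + 1) m + k' \<cdot> u_vec (k - 1) l (m + 1))
     + (X $ 3 $ 1) \<cdot> ((k' + l' + m') \<cdot> u_vec k l (m + 1) + l' \<cdot> u_vec (k + 1) (l + 1) m))"

definition act :: "complex \<Rightarrow> complex \<Rightarrow> mat3 \<Rightarrow> M \<Rightarrow> M" where
  "act \<mu>1 \<mu>2 X v = (\<Sum>i\<in>Poly_Mapping.keys v. Poly_Mapping.lookup v i \<cdot> act_basis \<mu>1 \<mu>2 X i)"

text \<open>
  The denominators are nonzero for all \<open>k\<close>, \<open>l\<close>, \<open>n\<close> exactly when \<open>\<mu>1 + \<mu>2\<close> is not an integer.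
\<close>

definition w_vec :: "complex \<Rightarrow> complex \<Rightarrow> int \<Rightarrow> int \<Rightarrow> nat \<Rightarrow> M" where
  "w_vec \<mu>1 \<mu>2 k l m =
     (let k' = of_int k - \<mu>1; l' = of_int l - \<mu>2 in
       \<Sum>n = 0..m. (of_nat (m choose n) * (pochhammer l' n / pochhammer (k' + l') n))
                    \<cdot> u_vec (k + int n) (l + int n) (m - n))"

definition simultaneous_eigenvector ::
    "(M \<Rightarrow> M) \<times> (M \<Rightarrow> M) \<times> (M \<Rightarrow> M) \<Rightarrow> complex \<times> complex \<times> complex \<Rightarrow> M \<Rightarrow> bool" where
  "simultaneous_eigenvector = (\<lambda>(T1, T2, T3) (a, b, c) v.
     v \<noteq> 0 \<and> T1 v = a \<cdot> v \<and> T2 v = b \<cdot> v \<and> T3 v = c \<cdot> v)"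

definition eigen_operators :: "complex \<Rightarrow> complex \<Rightarrow> (M \<Rightarrow> M) \<times> (M \<Rightarrow> M) \<times> (M \<Rightarrow> M)" where
  "eigen_operators \<mu>1 \<mu>2 =
     (act \<mu>1 \<mu>2 H1, act \<mu>1 \<mu>2 H2, act \<mu>1 \<mu>2 F12 \<circ> act \<mu>1 \<mu>2 E12)"


section \<open>Consistency of the definitions\<close>

lemmas sl3_entries = lie_bracket_def matrix_unit_def matrix_matrix_mult_def sum_3
  vec_eq_iff forall_3

lemma E12_eq: "E12 = matrix_unit 1 3"
  by (simp add: E12_def E1_def E2_def sl3_entries)

lemma F12_eq: "F12 = matrix_unit 3 1"
  by (simp add: F12_def F1_def F2_def sl3_entries)

lemma H1_eq: "H1 = matrix_unit 1 1 - matrix_unit 2 2"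
  by (simp add: H1_def E1_def F1_def sl3_entries)

lemma H2_eq: "H2 = matrix_unit 2 2 - matrix_unit 3 3"
  by (simp add: H2_def E2_def F2_def sl3_entries)

lemma in_sl3: "{E1, E2, E12, F1, F2, F12, H1, H2} \<subseteq> sl3"
  by (simp add: sl3_def trace_def E1_def E2_def F1_def F2_def E12_eq F12_eq H1_eq H2_eq
      matrix_unit_def sum_3)

lemma act_superset:
  assumes "finite S" "Poly_Mapping.keys v \<subseteq> S"
  shows "act \<mu>1 \<mu>2 X v = (\<Sum>i\<in>S. Poly_Mapping.lookup v i \<cdot> act_basis \<mu>1 \<mu>2 X i)"
  unfolding act_def using assms
  by (intro sum.mono_neutral_left) (auto simp: in_keys_iff)

lemma act_add: "act \<mu>1 \<mu>2 X (v + v') = act \<mu>1 \<mu>2 X v + act \<mu>1 \<mu>2 X v'"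
proof -
  have "Poly_Mapping.keys (v + v') \<subseteq> Poly_Mapping.keys v \<union> Poly_Mapping.keys v'"
    by (rule keys_add)
  then show ?thesis
    by (simp add: act_superset[of "Poly_Mapping.keys v \<union> Poly_Mapping.keys v'"] lookup_add M.scale_left_distrib
        sum.distrib)
qed

lemma act_scale: "act \<mu>1 \<mu>2 X (c \<cdot> v) = c \<cdot> act \<mu>1 \<mu>2 X v"
proof -
  have "Poly_Mapping.keys (c \<cdot> v) \<subseteq> Poly_Mapping.keys v"
    by (auto simp: in_keys_iff)
  then show ?thesis
    by (simp add: act_superset[of "Poly_Mapping.keys v"] M.scale_sum_right)
qed

lemma act_uminus: "act \<mu>1 \<mu>2 X (- v) = - act \<mu>1 \<mu>2 X v"
  using act_scale[of \<mu>1 \<mu>2 X "-1" v] by simp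

lemma act_diff: "act \<mu>1 \<mu>2 X (v - v') = act \<mu>1 \<mu>2 X v - act \<mu>1 \<mu>2 X v'"
  using act_add[of \<mu>1 \<mu>2 X v "- v'"] by (simp add: act_uminus)

lemma linear_act: "Vector_Spaces.linear scaleM scaleM (act \<mu>1 \<mu>2 X)"
  by unfold_locales (simp_all add: act_add act_scale)

lemma act_u: "act \<mu>1 \<mu>2 X (u_vec k l m) = act_basis \<mu>1 \<mu>2 X (k, l, m)"
  by (simp add: act_def u_vec_def)

lemma act_0 [simp]: "act \<mu>1 \<mu>2 X 0 = 0"
  by (simp add: act_def)

lemma M_expand:
  "v = (\<Sum>(k, l, m)\<in>Poly_Mapping.keys v. Poly_Mapping.lookup v (k, l, m) \<cdot> u_vec k l m)"
proof (rule poly_mapping_eqI)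
  fix i
  have "Poly_Mapping.lookup (\<Sum>j\<in>Poly_Mapping.keys v. Poly_Mapping.lookup v j \<cdot> Poly_Mapping.single j 1) i
      = (\<Sum>j\<in>Poly_Mapping.keys v. if j = i then Poly_Mapping.lookup v j else 0)"
    unfolding lookup_sum by (intro sum.cong) (auto simp: lookup_single when_def)
  also have "\<dots> = Poly_Mapping.lookup v i" by (simp add: sum.delta in_keys_iff)
  finally show "Poly_Mapping.lookup v i = Poly_Mapping.lookup (\<Sum>(k, l, m)\<in>Poly_Mapping.keys v. Poly_Mapping.lookup v (k, l, m) \<cdot> u_vec k l m) i"
    by (simp add: u_vec_def case_prod_unfold)
qed

lemma basis_family_u: "basis_family (\<lambda>(k, l, m). u_vec k l m)"
proof -
  let ?b = "\<lambda>i. Poly_Mapping.single i 1 :: M"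
  have b: "(\<lambda>(k, l, m). u_vec k l m) = ?b" by (auto simp: u_vec_def)
  have inj: "inj ?b"
  proof (rule injI)
    fix i j assume "?b i = ?b j"
    then have "Poly_Mapping.lookup (?b i) i = Poly_Mapping.lookup (?b j) i" by simp
    then show "i = j" by (simp add: lookup_single when_def split: if_splits)
  qed
  have "?b i \<notin> M.span (range ?b - {?b i})" for i
  proof
    assume "?b i \<in> M.span (range ?b - {?b i})"
    moreover have "M.subspace {v. Poly_Mapping.lookup v i = 0}"
      by (simp add: M.subspace_def lookup_add)
    moreover have "range ?b - {?b i} \<subseteq> {v. Poly_Mapping.lookup v i = 0}"
      by (auto simp: lookup_single when_def)
    ultimately have "?b i \<in> {v. Poly_Mapping.lookup v i = 0}"
      using M.span_minimal by blast
    then show False by simp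
  qed
  then have "M.independent (range ?b)"
    unfolding M.dependent_def by blast
  moreover have "v \<in> M.span (range ?b)" for v
  proof -
    have "(\<Sum>(k, l, m)\<in>Poly_Mapping.keys v. Poly_Mapping.lookup v (k, l, m) \<cdot> u_vec k l m)
        \<in> M.span (range ?b)"
      by (intro M.span_sum) (clarsimp simp: u_vec_def, intro M.span_scale M.span_base rangeI)
    then show ?thesis unfolding M_expand[symmetric] .
  qed
  then have "M.span (range ?b) = UNIV" by blast
  ultimately show ?thesis
    using inj unfolding basis_family_def b by blast
qed

context
  fixes \<mu>1 \<mu>2 :: complex and k l :: int and m :: nat and k' l' :: complex
  defines "k' \<equiv> of_int k - \<mu>1" and "l' \<equiv> of_int l - \<mu>2"
begin

lemmas act_entries = act_u act_basis_def Let_def E1_def E2_def F1_def F2_def E12_eq F12_eq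
  H1_eq H2_eq matrix_unit_def root1_def root2_def k'_def l'_def

lemma act_E1: "act \<mu>1 \<mu>2 E1 (u_vec k l m) = (- k') \<cdot> u_vec (k - 1) l m"
  by (rule poly_mapping_eqI) (simp add: act_entries lookup_add lookup_uminus algebra_simps)

lemma act_E2: "act \<mu>1 \<mu>2 E2 (u_vec k l m)
    = (- l') \<cdot> u_vec k (l - 1) m + of_nat m \<cdot> u_vec (k + 1) l (m - 1)"
  by (rule poly_mapping_eqI) (simp add: act_entries lookup_add lookup_uminus algebra_simps)

lemma act_E12: "act \<mu>1 \<mu>2 E12 (u_vec k l m) = (- of_nat m) \<cdot> u_vec k l (m - 1)"
  by (rule poly_mapping_eqI) (simp add: act_entries lookup_add lookup_uminus algebra_simps)

lemma act_F1: "act \<mu>1 \<mu>2 F1 (u_vec k l m)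
    = (k' - l' + of_nat m) \<cdot> u_vec (k + 1) l m + (- l') \<cdot> u_vec k (l - 1) (m + 1)"
  by (rule poly_mapping_eqI) (simp add: act_entries lookup_add lookup_uminus algebra_simps)

lemma act_F2: "act \<mu>1 \<mu>2 F2 (u_vec k l m)
    = l' \<cdot> u_vec k (l + 1) m + k' \<cdot> u_vec (k - 1) l (m + 1)"
  by (rule poly_mapping_eqI) (simp add: act_entries lookup_add lookup_uminus algebra_simps)

lemma act_F12: "act \<mu>1 \<mu>2 F12 (u_vec k l m)
    = (k' + l' + of_nat m) \<cdot> u_vec k l (m + 1) + l' \<cdot> u_vec (k + 1) (l + 1) m"
  by (rule poly_mapping_eqI) (simp add: act_entries lookup_add lookup_uminus algebra_simps)

lemma act_diagonal:
  assumes "\<And>i j. i \<noteq> j \<Longrightarrow> X $ i $ j = 0"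
  shows "act \<mu>1 \<mu>2 X (u_vec k l m)
    = (- ((k' + of_nat m) * root1 X + (l' + of_nat m) * root2 X)) \<cdot> u_vec k l m"
  using assms by (simp add: act_u act_basis_def Let_def k'_def l'_def)

end

lemma act_add_left: "act \<mu>1 \<mu>2 (X + Y) v = act \<mu>1 \<mu>2 X v + act \<mu>1 \<mu>2 Y v"
proof -
  have "act_basis \<mu>1 \<mu>2 (X + Y) i = act_basis \<mu>1 \<mu>2 X i + act_basis \<mu>1 \<mu>2 Y i" for i
    by (cases i, rule poly_mapping_eqI)
      (simp add: act_basis_def Let_def root1_def root2_def lookup_add algebra_simps)
  then show ?thesis
    by (simp add: act_def M.scale_right_distrib sum.distrib)
qed

lemma act_scale_left: "act \<mu>1 \<mu>2 (\<chi> i j. c * X $ i $ j) v = c \<cdot> act \<mu>1 \<mu>2 X v"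
proof -
  have "act_basis \<mu>1 \<mu>2 (\<chi> i j. c * X $ i $ j) i = c \<cdot> act_basis \<mu>1 \<mu>2 X i" for i
    by (cases i, rule poly_mapping_eqI)
      (simp add: act_basis_def Let_def root1_def root2_def lookup_add algebra_simps)
  then show ?thesis
    by (simp add: act_def M.scale_sum_right mult.commute)
qed

lemma act_sum: "act \<mu>1 \<mu>2 X (\<Sum>i\<in>S. g i) = (\<Sum>i\<in>S. act \<mu>1 \<mu>2 X (g i))"
  by (induction S rule: infinite_finite_induct) (simp_all add: act_add)


lemma act_zero_left: "act \<mu>1 \<mu>2 0 v = 0"
  using act_add_left[of \<mu>1 \<mu>2 0 0 v] by simp

lemma act_uminus_left: "act \<mu>1 \<mu>2 (- X) v = - act \<mu>1 \<mu>2 X v"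
  using act_add_left[of \<mu>1 \<mu>2 X "- X" v] by (simp add: act_zero_left eq_neg_iff_add_eq_0 add.commute)

lemma act_diff_left: "act \<mu>1 \<mu>2 (X - Y) v = act \<mu>1 \<mu>2 X v - act \<mu>1 \<mu>2 Y v"
  using act_add_left[of \<mu>1 \<mu>2 "X - Y" Y v] by simp

lemma bracket_matrix_unit:
  "lie_bracket (matrix_unit i j) (matrix_unit p q)
    = (if j = p then matrix_unit i q else 0) - (if q = i then matrix_unit p j else 0)"
proof -
  have "matrix_unit i j ** matrix_unit p q = (if j = p then matrix_unit i q else 0)" for i j p q
  proof -
    have "(if a = i \<and> c = j then 1 else 0 :: complex) * (if c = p \<and> b = q then 1 else 0)
        = (if c = j then if a = i \<and> j = p \<and> b = q then 1 else 0 else 0)" for a b c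
      by auto
    then show ?thesis
      by (simp add: vec_eq_iff matrix_matrix_mult_def matrix_unit_def)
  qed
  then show ?thesis by (simp add: lie_bracket_def)
qed

text \<open>
  Compatibility with the bracket is checked on matrix units and extended bilinearly. It holds for all
  matrices, since the formula for \<open>act\<close> only involves the diagonal through the roots.
\<close>

lemma act_bracket_unit:
  "\<forall>i j p q. act \<mu>1 \<mu>2 (matrix_unit i j) (act \<mu>1 \<mu>2 (matrix_unit p q) (u_vec k l m))
     - act \<mu>1 \<mu>2 (matrix_unit p q) (act \<mu>1 \<mu>2 (matrix_unit i j) (u_vec k l m))
    = act \<mu>1 \<mu>2 (lie_bracket (matrix_unit i j) (matrix_unit p q)) (u_vec k l m)"
proof -
  define \<kappa> where "\<kappa> = (\<lambda>k. complex_of_int k - \<mu>1)"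
  define \<nu> where "\<nu> = (\<lambda>l. complex_of_int l - \<mu>2)"
  have shift: "\<kappa> (k + 1) = \<kappa> k + 1" "\<kappa> (k - 1) = \<kappa> k - 1" "\<nu> (l + 1) = \<nu> l + 1"
    "\<nu> (l - 1) = \<nu> l - 1" for k l
    by (simp_all add: \<kappa>_def \<nu>_def)
  note unit_simps = act_u act_basis_def Let_def matrix_unit_def root1_def root2_def
    \<kappa>_def \<nu>_def
  have act_unit:
    "act \<mu>1 \<mu>2 (matrix_unit 1 2) (u_vec k l m) = (- \<kappa> k) \<cdot> u_vec (k - 1) l m"
    "act \<mu>1 \<mu>2 (matrix_unit 2 3) (u_vec k l m)
      = (- \<nu> l) \<cdot> u_vec k (l - 1) m + of_nat m \<cdot> u_vec (k + 1) l (m - 1)"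
    "act \<mu>1 \<mu>2 (matrix_unit 1 3) (u_vec k l m) = (- of_nat m) \<cdot> u_vec k l (m - 1)"
    "act \<mu>1 \<mu>2 (matrix_unit 2 1) (u_vec k l m)
      = (\<kappa> k - \<nu> l + of_nat m) \<cdot> u_vec (k + 1) l m + (- \<nu> l) \<cdot> u_vec k (l - 1) (m + 1)"
    "act \<mu>1 \<mu>2 (matrix_unit 3 2) (u_vec k l m)
      = \<nu> l \<cdot> u_vec k (l + 1) m + \<kappa> k \<cdot> u_vec (k - 1) l (m + 1)"
    "act \<mu>1 \<mu>2 (matrix_unit 3 1) (u_vec k l m)
      = (\<kappa> k + \<nu> l + of_nat m) \<cdot> u_vec k l (m + 1) + \<nu> l \<cdot> u_vec (k + 1) (l + 1) m"
    "act \<mu>1 \<mu>2 (matrix_unit 1 1) (u_vec k l m) = (- (\<kappa> k + of_nat m)) \<cdot> u_vec k l m"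
    "act \<mu>1 \<mu>2 (matrix_unit 2 2) (u_vec k l m) = (\<kappa> k - \<nu> l) \<cdot> u_vec k l m"
    "act \<mu>1 \<mu>2 (matrix_unit 3 3) (u_vec k l m) = (\<nu> l + of_nat m) \<cdot> u_vec k l m"
    for k l m
    by (rule poly_mapping_eqI; simp add: unit_simps lookup_add lookup_uminus algebra_simps)+
  consider "m = 0" | "m = 1" | n where "m = Suc (Suc n)"
    by (metis One_nat_def not0_implies_Suc)
  then show ?thesis
    unfolding forall_3 bracket_matrix_unit
    by cases
      (intro conjI; (rule poly_mapping_eqI,
        simp add: act_unit act_add act_scale act_diff_left act_uminus_left act_zero_left shift
          lookup_add lookup_minus del: M.scale_minus_left; (simp add: algebra_simps)?))+
qed

lemma mat3_induct:
  assumes unit: "\<And>i j. P (matrix_unit i j)"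
    and add: "\<And>X Y. P X \<Longrightarrow> P Y \<Longrightarrow> P (X + Y)"
    and scale: "\<And>c X. P X \<Longrightarrow> P (\<chi> i j. c * X $ i $ j)"
  shows "P X"
proof -
  have "(\<chi> i j. 0 * matrix_unit 1 1 $ i $ j) = (0 :: mat3)"
    by (simp add: vec_eq_iff)
  then have zero: "P 0"
    using scale[OF unit, of 0 1 1] by metis
  have sum: "P (sum g S)" if "\<And>i. P (g i)" for g :: "3 \<Rightarrow> mat3" and S
    by (induction S rule: infinite_finite_induct) (simp_all add: zero add that)
  have "P (\<Sum>i\<in>UNIV. \<Sum>j\<in>UNIV. \<chi> a b. X $ i $ j * matrix_unit i j $ a $ b)"
    by (intro sum scale unit)
  moreover have "(\<Sum>i\<in>UNIV. \<Sum>j\<in>UNIV. \<chi> a b. X $ i $ j * matrix_unit i j $ a $ b) = X"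
    by (simp add: vec_eq_iff forall_3 sum_3 matrix_unit_def)
  ultimately show ?thesis by simp
qed

lemma bracket_add_left: "lie_bracket (X + Y) Z = lie_bracket X Z + lie_bracket Y Z"
  by (simp add: lie_bracket_def vec_eq_iff matrix_matrix_mult_def sum_3 algebra_simps)

lemma bracket_add_right: "lie_bracket Z (X + Y) = lie_bracket Z X + lie_bracket Z Y"
  by (simp add: lie_bracket_def vec_eq_iff matrix_matrix_mult_def sum_3 algebra_simps)

lemma bracket_scale_left:
  "lie_bracket (\<chi> i j. c * X $ i $ j) Y = (\<chi> i j. c * lie_bracket X Y $ i $ j)"
  by (simp add: lie_bracket_def vec_eq_iff matrix_matrix_mult_def sum_3 algebra_simps)

lemma bracket_scale_right:
  "lie_bracket X (\<chi> i j. c * Y $ i $ j) = (\<chi> i j. c * lie_bracket X Y $ i $ j)"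
  by (simp add: lie_bracket_def vec_eq_iff matrix_matrix_mult_def sum_3 algebra_simps)

theorem act_bracket:
  "act \<mu>1 \<mu>2 (lie_bracket X Y) v
    = act \<mu>1 \<mu>2 X (act \<mu>1 \<mu>2 Y v) - act \<mu>1 \<mu>2 Y (act \<mu>1 \<mu>2 X v)"
proof -
  let ?a = "act \<mu>1 \<mu>2"
  have "?a (lie_bracket (matrix_unit i j) Y) (u_vec k l m)
      = ?a (matrix_unit i j) (?a Y (u_vec k l m)) - ?a Y (?a (matrix_unit i j) (u_vec k l m))"
    for i j k l m Y
    by (induction Y rule: mat3_induct)
      (simp_all add: act_bracket_unit bracket_add_right bracket_scale_right act_add_left
        act_scale_left act_add act_scale M.scale_right_diff_distrib)
  then have u: "?a (lie_bracket X Y) (u_vec k l m)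
      = ?a X (?a Y (u_vec k l m)) - ?a Y (?a X (u_vec k l m))" for k l m
    by (induction X rule: mat3_induct)
      (simp_all add: bracket_add_left bracket_scale_left act_add_left act_scale_left act_add
        act_scale M.scale_right_diff_distrib)
  have "?a (lie_bracket X Y) (\<Sum>i\<in>S. c i \<cdot> u_vec (f i) (g i) (h i))
      = ?a X (?a Y (\<Sum>i\<in>S. c i \<cdot> u_vec (f i) (g i) (h i)))
        - ?a Y (?a X (\<Sum>i\<in>S. c i \<cdot> u_vec (f i) (g i) (h i)))"
    for S :: "(int \<times> int \<times> nat) set" and c f g h
    by (simp add: act_sum act_scale u sum_subtractf M.scale_right_diff_distrib)
  from this[where S = "Poly_Mapping.keys v" and c = "Poly_Mapping.lookup v" and f = fst
      and g = "fst \<circ> snd" and h = "snd \<circ> snd"]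
  show ?thesis
    using M_expand[of v, symmetric] by (simp add: case_prod_unfold)
qed

end

(* The lemma rests on the two ladder relations e12 w_{k,l,m} = - m w_{k,l,m-1} and
   f12 w_{k,l,m} = (k - mu1 + l - mu2 + m) w_{k,l,m+1}. Since w_{k,l,m} is u_{k,l,m} plus vectors
   with smaller third index, the w's form a basis. The weights determine a = k + m and b = l + m;
   with s = a + b - mu1 - mu2 the eigenvalue of f12 e12 is - m (s - m - 1), and two different
   values of m giving the same eigenvalue would force s to be an integer. *)

theory Submission
  imports Defs
begin

text \<open>In the coordinates of the \<open>u\<close>-basis, \<open>b i\<close> has leading
  coefficient 1 at \<open>i\<close> and its other terms have strictly smaller rank \<open>r\<close>.
  A relation is refuted at an index of maximal rank, and spanning follows by induction on the
  rank.\<close>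

lemma unitriangular_basis_family:
  fixes b :: "int \<times> int \<times> nat \<Rightarrow> M" and r :: "int \<times> int \<times> nat \<Rightarrow> nat"
  assumes diag: "\<And>i. Poly_Mapping.lookup (b i) i = 1"
    and lower: "\<And>i j. Poly_Mapping.lookup (b i) j \<noteq> 0 \<Longrightarrow> j = i \<or> r j < r i"
  shows "basis_family b"
proof -
  have inj: "inj b"
  proof (rule injI, rule ccontr)
    \<comment> \<open>Each of the two distinct indices would occur in the vector of the other,
      giving both \<open>r j < r i\<close> and \<open>r i < r j\<close>.\<close>
    fix i j assume eq: "b i = b j" and "i \<noteq> j"
    then show False
      using lower[of i j] lower[of j i] diag[of i] diag[of j] by auto
  qed
  have "M.independent (range b)"
    unfolding M.dependent_explicit
  proof (rule notI, elim exE conjE)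
    fix T c
    assume fin: "finite T" and sub: "T \<subseteq> range b" and zero: "(\<Sum>v\<in>T. c v \<cdot> v) = 0"
      and ex: "\<exists>v\<in>T. c v \<noteq> 0"
    define I where "I = {i. b i \<in> T \<and> c (b i) \<noteq> 0}"
    have "finite I"
      by (rule finite_subset[OF _ finite_vimageI[OF fin inj]]) (auto simp: I_def)
    moreover have "\<exists>i. i \<in> I"
      using ex sub unfolding I_def by blast
    ultimately obtain i where i: "i \<in> I" and max: "\<And>j. j \<in> I \<Longrightarrow> r j \<le> r i"
      using Max_in[of "r ` I"] Max_ge[of "r ` I"]
      by (metis (no_types, lifting) finite_imageI image_iff image_is_empty empty_iff)
    \<comment> \<open>By maximality of \<open>r i\<close>, no other vector with nonzero coefficient
      has a coordinate at \<open>i\<close>, so the relation read at \<open>i\<close> reduces to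
      \<open>c (b i) = 0\<close>.\<close>
    have "c v * Poly_Mapping.lookup v i = 0" if v: "v \<in> T - {b i}" for v
    proof -
      obtain j where "v = b j" using v sub by blast
      then show ?thesis
        using v max[of j] lower[of j i] by (fastforce simp: I_def)
    qed
    then have "(\<Sum>v\<in>T. c v * Poly_Mapping.lookup v i) = (\<Sum>v\<in>{b i}. c v * Poly_Mapping.lookup v i)"
      using fin i by (intro sum.mono_neutral_right) (auto simp: I_def)
    moreover have "(\<Sum>v\<in>T. c v * Poly_Mapping.lookup v i) = 0"
      using arg_cong[OF zero, of "\<lambda>v. Poly_Mapping.lookup v i"] by (simp add: lookup_sum)
    ultimately show False
      using i diag[of i] by (simp add: I_def)
  qed
  moreover have single: "Poly_Mapping.single i 1 \<in> M.span (range b)" for i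
  proof (induction "r i" arbitrary: i rule: less_induct)
    case less
    \<comment> \<open>The coordinate at \<open>i\<close> cancels because the leading coefficient is
      1, so only indices of smaller rank remain in \<open>d\<close> and the induction hypothesis
      covers it.\<close>
    define d where "d = b i - Poly_Mapping.single i 1"
    have "r j < r i" if "j \<in> Poly_Mapping.keys d" for j
      using that lower[of i j] diag[of i]
      by (auto simp: d_def in_keys_iff lookup_minus lookup_single when_def split: if_splits)
    then have "(\<Sum>(k, l, m)\<in>Poly_Mapping.keys d. Poly_Mapping.lookup d (k, l, m) \<cdot> u_vec k l m)
        \<in> M.span (range b)"
      using less by (intro M.span_sum) (auto simp: u_vec_def intro!: M.span_scale)
    then have "b i - d \<in> M.span (range b)"
      unfolding M_expand[symmetric] by (rule M.span_diff[OF M.span_base[OF rangeI]])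
    then show ?case by (simp add: d_def)
  qed
  moreover have "M.span (range b) = UNIV"
  proof -
    have "range (\<lambda>(k, l, m). u_vec k l m) \<subseteq> M.span (range b)"
      using single by (auto simp: u_vec_def)
    then show ?thesis
      using basis_family_u M.span_minimal[OF _ M.subspace_span] unfolding basis_family_def by blast
  qed
  ultimately show ?thesis
    using inj by (simp add: basis_family_def)
qed

lemma lookup_w_vec:
  "Poly_Mapping.lookup (w_vec \<mu>1 \<mu>2 k l m) (k, l, m) = 1"
proof -
  have "Poly_Mapping.lookup (w_vec \<mu>1 \<mu>2 k l m) (k, l, m) = (\<Sum>n = 0..m. if n = 0 then 1 else 0)"
    unfolding w_vec_def Let_def lookup_sum
    by (rule sum.cong) (auto simp: u_vec_def lookup_single when_def)
  then show ?thesis by simp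
qed

text \<open>The \<open>n\<close>-th summand of \<open>w_vec\<close> has third index
  \<open>m - n\<close>, so the third index serves as the rank in the triangularity
  criterion.\<close>

lemma lookup_w_vec_nonzero:
  assumes "Poly_Mapping.lookup (w_vec \<mu>1 \<mu>2 k l m) j \<noteq> 0"
  shows "j = (k, l, m) \<or> snd (snd j) < m"
proof -
  obtain n where "n \<le> m" "Poly_Mapping.lookup (u_vec (k + int n) (l + int n) (m - n)) j \<noteq> 0"
    using assms unfolding w_vec_def Let_def lookup_sum
    by (auto elim!: sum.not_neutral_contains_not_neutral)
  then show ?thesis
    by (cases "n = 0") (auto simp: u_vec_def lookup_single when_def split: if_splits)
qed

lemma w_vec_neq_0: "w_vec \<mu>1 \<mu>2 k l m \<noteq> 0"
  using lookup_w_vec[of \<mu>1 \<mu>2 k l m] by auto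

lemma basis_family_w: "basis_family (\<lambda>(k, l, m). w_vec \<mu>1 \<mu>2 k l m)"
  by (rule unitriangular_basis_family[where r = "snd \<circ> snd"])
    (auto simp: lookup_w_vec dest: lookup_w_vec_nonzero)

text \<open>Along the sum, \<open>k\<close> and \<open>l\<close> rise by \<open>n\<close> while
  \<open>m\<close> falls by \<open>n\<close>. Hence \<open>k + m\<close> and \<open>l + m\<close>
  are constant and all summands have the same weight.\<close>

lemma act_diagonal_w:
  assumes "\<And>i j. i \<noteq> j \<Longrightarrow> X $ i $ j = 0"
  shows "act \<mu>1 \<mu>2 X (w_vec \<mu>1 \<mu>2 k l m)
    = (- ((of_int k - \<mu>1 + of_nat m) * root1 X + (of_int l - \<mu>2 + of_nat m) * root2 X))
      \<cdot> w_vec \<mu>1 \<mu>2 k l m"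
proof -
  have diag: "act \<mu>1 \<mu>2 X (u_vec i j p) = (- ((of_int i - \<mu>1 + of_nat p) * root1 X
      + (of_int j - \<mu>2 + of_nat p) * root2 X)) \<cdot> u_vec i j p" for i j p
    by (rule act_diagonal) (rule assms)
  have shift: "of_int (j + int n) - c + of_nat (m - n) = of_int j - c + (of_nat m :: complex)"
    if "n \<le> m" for j n c
    using that by (simp add: of_nat_diff)
  show ?thesis
    unfolding w_vec_def Let_def act_sum act_scale diag M.scale_sum_right
  proof (rule sum.cong)
    fix n assume "n \<in> {0..m}"
    then have "n \<le> m" by simp
    show "(of_nat (m choose n) * (pochhammer (of_int l - \<mu>2) n
          / pochhammer (of_int k - \<mu>1 + (of_int l - \<mu>2)) n)) \<cdot>
        (- ((of_int (k + int n) - \<mu>1 + of_nat (m - n)) * root1 X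
          + (of_int (l + int n) - \<mu>2 + of_nat (m - n)) * root2 X))
        \<cdot> u_vec (k + int n) (l + int n) (m - n)
      = (- ((of_int k - \<mu>1 + of_nat m) * root1 X + (of_int l - \<mu>2 + of_nat m) * root2 X)) \<cdot>
        (of_nat (m choose n) * (pochhammer (of_int l - \<mu>2) n
          / pochhammer (of_int k - \<mu>1 + (of_int l - \<mu>2)) n))
        \<cdot> u_vec (k + int n) (l + int n) (m - n)"
      unfolding shift[OF \<open>n \<le> m\<close>] by (rule M.scale_left_commute)
  qed simp
qed

lemma act_E12_w:
  "act \<mu>1 \<mu>2 E12 (w_vec \<mu>1 \<mu>2 k l m) = (- of_nat m) \<cdot> w_vec \<mu>1 \<mu>2 k l (m - 1)"
proof (cases m)
  case 0
  then show ?thesis by (simp add: w_vec_def act_E12 act_scale)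
next
  case (Suc p)
  \<comment> \<open>The factor \<open>Suc p - n\<close> produced by \<open>E12\<close> turns the
    binomials for \<open>m\<close> into \<open>m\<close> times those for
    \<open>m - 1\<close>.\<close>
  have absorb: "of_nat (Suc p choose n) * of_nat (Suc p - n) = (of_nat (Suc p) * of_nat (p choose n) :: complex)"
    for n
    using binomial_absorb_comp[of "Suc p" n]
    by (metis diff_Suc_1 mult.commute of_nat_mult)
  define c where "c n = pochhammer (of_int l - \<mu>2) n
      / pochhammer (of_int k - \<mu>1 + (of_int l - \<mu>2)) n" for n
  \<comment> \<open>The sum still runs up to \<open>Suc p\<close>, but its last term has coefficient
    \<open>p choose Suc p = 0\<close>, so the truncated \<open>p - n\<close> there is
    harmless.\<close>
  have "act \<mu>1 \<mu>2 E12 (w_vec \<mu>1 \<mu>2 k l m)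
      = (\<Sum>n = 0..Suc p. (- (of_nat (Suc p) * of_nat (p choose n) * c n)) \<cdot> u_vec (k + int n) (l + int n) (p - n))"
    unfolding w_vec_def Let_def act_sum act_scale act_E12 Suc absorb[symmetric] c_def M.scale_scale
    by (rule sum.cong) (simp_all add: ac_simps del: of_nat_diff)
  also have "\<dots> = (- of_nat m) \<cdot> w_vec \<mu>1 \<mu>2 k l (m - 1)"
    unfolding w_vec_def Let_def M.scale_sum_right c_def Suc
    by (simp add: binomial_eq_0 mult.assoc del: of_nat_Suc M.scale_minus_left)
  finally show ?thesis .
qed

lemma act_F12_w:
  assumes "\<mu>1 + \<mu>2 \<notin> \<int>"
  shows "act \<mu>1 \<mu>2 F12 (w_vec \<mu>1 \<mu>2 k l m)
    = (of_int k - \<mu>1 + (of_int l - \<mu>2) + of_nat m) \<cdot> w_vec \<mu>1 \<mu>2 k l (Suc m)"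
proof -
  define s where "s = of_int k - \<mu>1 + (of_int l - \<mu>2)"
  define l' where "l' = of_int l - \<mu>2"
  define c where "c n = pochhammer l' n / pochhammer s n" for n
  \<comment> \<open>\<open>U n\<close> is the \<open>n\<close>-th vector in the sum for
    \<open>w_vec\<close> at \<open>Suc m\<close>. The action of \<open>F12\<close> sends the
    \<open>n\<close>-th term at \<open>m\<close> to \<open>A n\<close> times \<open>U n\<close> plus
    \<open>B n\<close> times \<open>U (Suc n)\<close>, and \<open>D n\<close> is the coefficient
    required on the right. In \<open>A n\<close>, \<open>s + m + n\<close> is
    \<open>s + 2 * n + (m - n)\<close>.\<close>
  define U where "U n = u_vec (k + int n) (l + int n) (Suc m - n)" for n
  define A where "A n = of_nat (m choose n) * c n * (s + of_nat m + of_nat n)" for n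
  define B where "B n = of_nat (m choose n) * c n * (l' + of_nat n)" for n
  define D where "D n = (s + of_nat m) * (of_nat (Suc m choose n) * c n)" for n
  have s: "s + of_nat n \<noteq> 0" for n
  proof
    assume "s + of_nat n = 0"
    then have "\<mu>1 + \<mu>2 = of_int (k + l + int n)" by (simp add: s_def algebra_simps)
    then show False using assms Ints_of_int by metis
  qed
  \<comment> \<open>This is the recursion of the raising factorials with the denominator cleared,
    which is possible since \<open>s\<close> is not an integer. It brings \<open>B n\<close> to the
    common factor \<open>c (Suc n)\<close>.\<close>
  have step: "c n * (l' + of_nat n) = c (Suc n) * (s + of_nat n)" for n
    using s[of n] by (simp add: c_def pochhammer_Suc)
  have AB: "A (Suc n) + B n = D (Suc n)" for n
  proof -
    define x where "x = (of_nat (m choose n) :: complex)"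
    define y where "y = (of_nat (m choose Suc n) :: complex)"
    \<comment> \<open>By Pascal's rule \<open>x + y\<close> is \<open>Suc m choose Suc n\<close>, so
      this is the absorption identity; it makes the error term in the computation below
      vanish.\<close>
    have xy: "(of_nat m + 1) * x = (x + y) * (of_nat n + 1)"
      using arg_cong[OF Suc_times_binomial_eq[of m n], of "of_nat :: nat \<Rightarrow> complex"]
      by (simp add: x_def y_def add.commute del: of_nat_Suc) (simp add: algebra_simps)
    have "A (Suc n) + B n = y * c (Suc n) * (s + of_nat m + of_nat n + 1) + x * (c (Suc n) * (s + of_nat n))"
      by (simp add: A_def B_def x_def y_def mult.assoc step add.assoc add.commute)
    also have "\<dots> = (s + of_nat m) * ((x + y) * c (Suc n))
        + c (Suc n) * ((x + y) * (of_nat n + 1) - (of_nat m + 1) * x)"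
      by (simp add: algebra_simps)
    also have "\<dots> = D (Suc n)"
      unfolding xy[symmetric] by (simp add: D_def x_def y_def)
    finally show ?thesis .
  qed
  have "act \<mu>1 \<mu>2 F12 (w_vec \<mu>1 \<mu>2 k l m) = (\<Sum>n = 0..m. A n \<cdot> U n + B n \<cdot> U (Suc n))"
    unfolding w_vec_def Let_def act_sum act_scale act_F12
  proof (rule sum.cong)
    fix n assume "n \<in> {0..m}"
    then show "(of_nat (m choose n) * (pochhammer (of_int l - \<mu>2) n
          / pochhammer (of_int k - \<mu>1 + (of_int l - \<mu>2)) n)) \<cdot>
        ((of_int (k + int n) - \<mu>1 + (of_int (l + int n) - \<mu>2) + of_nat (m - n))
            \<cdot> u_vec (k + int n) (l + int n) (m - n + 1)
          + (of_int (l + int n) - \<mu>2) \<cdot> u_vec (k + int n + 1) (l + int n + 1) (m - n))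
        = A n \<cdot> U n + B n \<cdot> U (Suc n)"
      by (simp add: M.scale_right_distrib A_def B_def U_def c_def s_def l'_def of_nat_diff
          Suc_diff_le ac_simps diff_add_eq add_diff_eq)
  qed simp
  \<comment> \<open>Adding the term \<open>A (Suc m)\<close> changes nothing, as
    \<open>m choose Suc m = 0\<close>. After an index shift the coefficients are compared by
    \<open>AB\<close>, with \<open>A 0 = D 0\<close> at the boundary.\<close>
  also have "\<dots> = (\<Sum>n = 0..Suc m. A n \<cdot> U n) + (\<Sum>n = 0..m. B n \<cdot> U (Suc n))"
    by (simp add: sum.distrib A_def)
  also have "\<dots> = A 0 \<cdot> U 0 + (\<Sum>n = 0..m. (A (Suc n) + B n) \<cdot> U (Suc n))"
    by (simp add: sum.atLeast0_atMost_Suc_shift sum.distrib M.scale_left_distrib add.assoc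
        del: sum.atLeast0_atMost_Suc sum.cl_ivl_Suc)
  also have "\<dots> = (\<Sum>n = 0..Suc m. D n \<cdot> U n)"
    unfolding AB sum.atLeast0_atMost_Suc_shift by (simp add: A_def D_def c_def)
  also have "\<dots> = (s + of_nat m) \<cdot> w_vec \<mu>1 \<mu>2 k l (Suc m)"
    unfolding w_vec_def Let_def M.scale_sum_right M.scale_scale D_def U_def c_def s_def l'_def ..
  finally show ?thesis by (simp add: s_def)
qed

lemma act_F12_E12_w:
  assumes "\<mu>1 + \<mu>2 \<notin> \<int>"
  shows "act \<mu>1 \<mu>2 F12 (act \<mu>1 \<mu>2 E12 (w_vec \<mu>1 \<mu>2 k l m))
    = (- of_nat m * (of_int k - \<mu>1 + (of_int l - \<mu>2) + of_nat m - 1)) \<cdot> w_vec \<mu>1 \<mu>2 k l m"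
  by (cases m) (simp_all add: act_E12_w act_scale act_F12_w[OF assms])

text \<open>The first two entries are the weight, with the Cartan matrix entries 2 and -1 as values
  of the roots on the coroots. The third is the product of the two ladder coefficients.\<close>

definition w_eigenvalue :: "complex \<Rightarrow> complex \<Rightarrow> int \<Rightarrow> int \<Rightarrow> nat \<Rightarrow> complex \<times> complex \<times> complex" where
  "w_eigenvalue \<mu>1 \<mu>2 k l m =
     (let k' = of_int k - \<mu>1; l' = of_int l - \<mu>2; m' = of_nat m in
       (- (2 * (k' + m') - (l' + m')), - (2 * (l' + m') - (k' + m')), - m' * (k' + l' + m' - 1)))"

text \<open>Since \<open>w_vec\<close> is nonzero, its eigenvalue triple is unique. The equivalence
  thus gives existence and reduces separation to injectivity of \<open>w_eigenvalue\<close>.\<close>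

lemma simultaneous_eigenvector_w:
  assumes "\<mu>1 + \<mu>2 \<notin> \<int>"
  shows "simultaneous_eigenvector (eigen_operators \<mu>1 \<mu>2) ev (w_vec \<mu>1 \<mu>2 k l m)
    \<longleftrightarrow> ev = w_eigenvalue \<mu>1 \<mu>2 k l m"
proof -
  have H: "H1 $ i $ j = 0" "H2 $ i $ j = 0" if "i \<noteq> j" for i j
    using that by (auto simp: H1_eq H2_eq matrix_unit_def)
  have roots: "root1 H1 = 2" "root2 H1 = -1" "root1 H2 = -1" "root2 H2 = 2"
    by (simp_all add: root1_def root2_def H1_eq H2_eq matrix_unit_def)
  have act:
    "act \<mu>1 \<mu>2 H1 (w_vec \<mu>1 \<mu>2 k l m) = fst (w_eigenvalue \<mu>1 \<mu>2 k l m) \<cdot> w_vec \<mu>1 \<mu>2 k l m"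
    "act \<mu>1 \<mu>2 H2 (w_vec \<mu>1 \<mu>2 k l m) = fst (snd (w_eigenvalue \<mu>1 \<mu>2 k l m)) \<cdot> w_vec \<mu>1 \<mu>2 k l m"
    "act \<mu>1 \<mu>2 F12 (act \<mu>1 \<mu>2 E12 (w_vec \<mu>1 \<mu>2 k l m))
      = snd (snd (w_eigenvalue \<mu>1 \<mu>2 k l m)) \<cdot> w_vec \<mu>1 \<mu>2 k l m"
    by (simp_all add: act_diagonal_w H roots act_F12_E12_w[OF assms] w_eigenvalue_def Let_def
        mult.commute)
  show ?thesis
    by (cases ev) (auto simp: simultaneous_eigenvector_def eigen_operators_def act w_vec_neq_0
        M.scale_cancel_right prod_eq_iff)
qed

lemma w_eigenvalue_inject:
  assumes "\<mu>1 + \<mu>2 \<notin> \<int>" and eq: "w_eigenvalue \<mu>1 \<mu>2 k l m = w_eigenvalue \<mu>1 \<mu>2 k' l' m'"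
  shows "(k, l, m) = (k', l', m')"
proof -
  define a b a' b' where ab: "a = k + int m" "b = l + int m" "a' = k' + int m'" "b' = l' + int m'"
  note ev = eq[unfolded w_eigenvalue_def Let_def prod.inject]
  \<comment> \<open>The Cartan matrix is invertible, so the first two eigenvalues determine
    \<open>a\<close> and \<open>b\<close>.\<close>
  have "complex_of_int (2 * a - b) = of_int (2 * a' - b')" "complex_of_int (2 * b - a) = of_int (2 * b' - a')"
    using ev by (simp_all add: ab algebra_simps)
  then have "a = a'" "b = b'" unfolding of_int_eq_iff by simp_all
  then have k': "k' = k + int m - int m'" and l': "l' = l + int m - int m'"
    by (simp_all add: ab)
  \<comment> \<open>With \<open>a\<close> and \<open>b\<close> fixed, the third eigenvalue is
    \<open>- m * (t - m)\<close>. Two such values differ, up to sign, by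
    \<open>(m - m') * (t - m - m')\<close>, and the second factor is nonzero because
    \<open>t\<close> is not an integer.\<close>
  define t where "t = of_int (a + b) - (\<mu>1 + \<mu>2) - 1"
  have "of_nat m * (t - of_nat m) = of_nat m' * (t - of_nat m')"
    using ev by (simp add: t_def ab k' l' algebra_simps)
  then have "(of_nat m - of_nat m') * (t - of_nat m - of_nat m') = 0"
    by (simp add: algebra_simps)
  moreover have "t - of_nat m - of_nat m' \<noteq> 0"
  proof
    assume "t - of_nat m - of_nat m' = 0"
    then have "\<mu>1 + \<mu>2 = of_int (a + b - 1 - int m - int m')"
      by (simp add: t_def algebra_simps)
    then show False using assms(1) Ints_of_int by metis
  qed
  ultimately have "m = m'" by simp
  then show ?thesis using k' l' by simp
qed

theorem lemma4p1:
  fixes \<mu>1 \<mu>2 :: complex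
  assumes "\<mu>1 + \<mu>2 \<notin> \<int>"
  shows "basis_family (\<lambda>(k, l, m). w_vec \<mu>1 \<mu>2 k l m)
    \<and> (\<forall>k l m. \<exists>ev. simultaneous_eigenvector (eigen_operators \<mu>1 \<mu>2) ev (w_vec \<mu>1 \<mu>2 k l m))
    \<and> (\<forall>k l m k' l' m' ev.
        simultaneous_eigenvector (eigen_operators \<mu>1 \<mu>2) ev (w_vec \<mu>1 \<mu>2 k l m) \<longrightarrow>
        simultaneous_eigenvector (eigen_operators \<mu>1 \<mu>2) ev (w_vec \<mu>1 \<mu>2 k' l' m') \<longrightarrow>
        (k, l, m) = (k', l', m'))"
  unfolding simultaneous_eigenvector_w[OF assms]
  using basis_family_w w_eigenvalue_inject[OF assms] by blast

end
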